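(* The gamma function $\Gamma$ (restricted to $\mathbb{R}^+$) is the only function $f:\mathbb{R}^+\to\mathbb{R}^+$ that has the three properties: (a) $f(x+1)=xf(x)$ for all $x>0$; (b) $f(1)=1$; (c) $f$ is $\log$-concave of the second order (on $\mathbb{R}^+$).
   Context: $\mathbb{R}^+=(0,\infty)$. For a real function $h$ on an interval $I$ and points $x_0<x_1<\cdots$ of $I$, the divided differences are defined by $[x_0;h]=h(x_0)$ and $[x_0,\dots,x_k;h]=\frac{[x_1,\dots,x_k;h]-[x_0,\dots,x_{k-1};h]}{x_k-x_0}$ for $k\ge1$. A positive function $f$ on $I$ is $\log$-concave of the second order (of order two) if $[x_0,x_1,x_2,x_3;\log f]\le 0$ for all $x_0<x_1<x_2<x_3$ in $I$. *)

theory Defs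
  imports "HOL-Analysis.Analysis"
begin

text \<open>The divided difference \<open>[x\<^sub>0, \<dots>, x\<^sub>k; h]\<close>, with the nodes given as a list. The value for
  the empty list is a dummy.\<close>

function divided_diff :: "real list \<Rightarrow> (real \<Rightarrow> real) \<Rightarrow> real" where
  "divided_diff [] h = 0"
| "divided_diff [x] h = h x"
| "divided_diff (x # y # ys) h =
     (divided_diff (y # ys) h - divided_diff (butlast (x # y # ys)) h) / (last (y # ys) - x)"
  by pat_completeness auto
termination
  by (relation "Wellfounded.measure (length \<circ> fst)") auto

definition log_concave_order2_on :: "real set \<Rightarrow> (real \<Rightarrow> real) \<Rightarrow> bool" where
  "log_concave_order2_on I f \<longleftrightarrow>
     (\<forall>x\<in>I. f x > 0) \<and>
     (\<forall>x0\<in>I. \<forall>x1\<in>I. \<forall>x2\<in>I. \<forall>x3\<in>I. x0 < x1 \<and> x1 < x2 \<and> x2 < x3 \<longrightarrow>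
        divided_diff [x0, x1, x2, x3] (\<lambda>x. ln (f x)) \<le> 0)"

end

theory Submission
  imports Defs "HOL-Real_Asymp.Real_Asymp"
begin

text \<open>Put \<open>h = ln \<circ> f\<close>. If the third divided differences of \<open>h\<close> are nonpositive, then between
  \<open>m + 1\<close> and \<open>m + 2\<close> the function \<open>h\<close> lies above the quadratic polynomial interpolating it at
  \<open>m, m + 1, m + 2\<close> and below the one interpolating it at \<open>m + 1, m + 2, m + 3\<close>. For integer \<open>m\<close>
  these polynomials are determined by the functional equation and \<open>f 1 = 1\<close>, and they differ by at
  most a multiple of the third difference of \<open>h\<close> at \<open>m\<close>, which tends to \<open>0\<close>. Hence for any two
  solutions \<open>f\<close> and \<open>g\<close> the \<open>1\<close>-periodic function \<open>ln (f x / g x)\<close> vanishes. That \<open>Gamma\<close> is a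
  solution follows from the mean value theorem for divided differences, as the third derivative
  of \<open>ln Gamma\<close> is the negative function \<open>Polygamma 2\<close>.\<close>

lemma divided_diff_3:
  "divided_diff [x0, x1, x2, x3] h =
     ((((h x3 - h x2) / (x3 - x2) - (h x2 - h x1) / (x2 - x1)) / (x3 - x1)) -
      (((h x2 - h x1) / (x2 - x1) - (h x1 - h x0) / (x1 - x0)) / (x2 - x0))) / (x3 - x0)"
  by simp

lemma log_concave_order2_onD:
  assumes "log_concave_order2_on I f" "{x0, x1, x2, x3} \<subseteq> I" "x0 < x1" "x1 < x2" "x2 < x3"
  shows "divided_diff [x0, x1, x2, x3] (\<lambda>x. ln (f x)) \<le> 0"
  using assms unfolding log_concave_order2_on_def by blast

lemma rolle_zero:
  fixes f f' :: "real \<Rightarrow> real"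
  assumes "a < b" "f a = 0" "f b = 0"
    and "\<And>x. a \<le> x \<Longrightarrow> x \<le> b \<Longrightarrow> (f has_real_derivative f' x) (at x)"
  obtains z where "a < z" "z < b" "f' z = 0"
proof -
  obtain z where "a < z" "z < b" "f b - f a = (b - a) * f' z"
    using MVT2[OF \<open>a < b\<close>] assms(4) by metis
  thus thesis using that assms by auto
qed

text \<open>The interpolation error vanishes at all four nodes, so three rounds of Rolle leave a
  zero of its third derivative \<open>h3 x - 6 * c\<close>, where \<open>c\<close> is the leading
  coefficient of the cubic.\<close>

lemma divided_diff_3_mean_value:
  fixes h h1 h2 h3 :: "real \<Rightarrow> real"
  assumes ord: "x0 < x1" "x1 < x2" "x2 < x3"
    and h: "\<And>x. x0 \<le> x \<Longrightarrow> x \<le> x3 \<Longrightarrow> (h has_real_derivative h1 x) (at x)"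
    and h1: "\<And>x. x0 \<le> x \<Longrightarrow> x \<le> x3 \<Longrightarrow> (h1 has_real_derivative h2 x) (at x)"
    and h2: "\<And>x. x0 \<le> x \<Longrightarrow> x \<le> x3 \<Longrightarrow> (h2 has_real_derivative h3 x) (at x)"
  obtains z where "x0 < z" "z < x3" "divided_diff [x0, x1, x2, x3] h = h3 z / 6"
proof -
  define a where "a = (h x1 - h x0) / (x1 - x0)"
  define b where "b = ((h x2 - h x1) / (x2 - x1) - a) / (x2 - x0)"
  define c where "c = divided_diff [x0, x1, x2, x3] h"
  \<comment> \<open>the error of cubic interpolation at the four nodes, in Newton form\<close>
  define g where "g x = h x - h x0 - a * (x - x0) - b * ((x - x0) * (x - x1)) -
    c * ((x - x0) * (x - x1) * (x - x2))" for x
  define g1 where "g1 x = h1 x - a - b * ((x - x0) + (x - x1)) -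
    c * ((x - x0) * (x - x1) + (x - x0) * (x - x2) + (x - x1) * (x - x2))" for x
  define g2 where "g2 x = h2 x - 2 * b - 2 * c * ((x - x0) + (x - x1) + (x - x2))" for x
  define g3 where "g3 x = h3 x - 6 * c" for x
  have d: "(g has_real_derivative g1 x) (at x)" if "x0 \<le> x" "x \<le> x3" for x
    unfolding g_def g1_def
    by (auto intro!: derivative_eq_intros h that simp: algebra_simps)
  have d1: "(g1 has_real_derivative g2 x) (at x)" if "x0 \<le> x" "x \<le> x3" for x
    unfolding g1_def g2_def
    by (auto intro!: derivative_eq_intros h1 that simp: algebra_simps)
  have d2: "(g2 has_real_derivative g3 x) (at x)" if "x0 \<le> x" "x \<le> x3" for x
    unfolding g2_def g3_def
    by (auto intro!: derivative_eq_intros h2 that)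
  have z0: "g x0 = 0" by (simp add: g_def)
  have z1: "g x1 = 0" using ord by (simp add: g_def a_def)
  have z2: "g x2 = 0"
  proof -
    define s where "s = (h x2 - h x1) / (x2 - x1)"
    have 1: "s * (x2 - x1) = h x2 - h x1" using ord by (simp add: s_def)
    have 2: "b * (x2 - x0) = s - a" using ord by (simp add: b_def s_def)
    have 3: "a * (x1 - x0) = h x1 - h x0" using ord by (simp add: a_def)
    show ?thesis unfolding g_def using 1 2 3 by algebra
  qed
  have z3: "g x3 = 0"
  proof -
    \<comment> \<open>\<open>e\<close>, \<open>s\<close> and \<open>b\<close> are the divided
      differences of \<open>h\<close> over \<open>x1, x2, x3\<close>, over \<open>x1, x2\<close> and
      over \<open>x0, x1, x2\<close>. With denominators cleared, their recursions become polynomial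
      identities that imply the claim.\<close>
    define e where "e = ((h x3 - h x2) / (x3 - x2) - (h x2 - h x1) / (x2 - x1)) / (x3 - x1)"
    define s where "s = (h x2 - h x1) / (x2 - x1)"
    have 1: "c * (x3 - x0) = e - b"
      using ord by (simp add: c_def e_def b_def a_def)
    have 2: "e * (x3 - x1) * (x3 - x2) = h x3 - h x2 - s * (x3 - x2)"
    proof -
      have "e * (x3 - x1) = (h x3 - h x2) / (x3 - x2) - s" using ord by (simp add: e_def s_def)
      moreover have "(h x3 - h x2) / (x3 - x2) * (x3 - x2) = h x3 - h x2" using ord by simp
      ultimately show ?thesis by (simp only: left_diff_distrib)
    qed
    have 3: "s * (x2 - x1) = h x2 - h x1" using ord by (simp add: s_def)
    have 4: "b * (x2 - x0) = s - a" using ord by (simp add: b_def s_def)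
    have 5: "a * (x1 - x0) = h x1 - h x0" using ord by (simp add: a_def)
    show ?thesis unfolding g_def using 1 2 3 4 5 by algebra
  qed
  obtain u1 where u1: "x0 < u1" "u1 < x1" "g1 u1 = 0"
    by (rule rolle_zero[of x0 x1 g g1]) (use ord z0 z1 d in auto)
  obtain u2 where u2: "x1 < u2" "u2 < x2" "g1 u2 = 0"
    by (rule rolle_zero[of x1 x2 g g1]) (use ord z1 z2 d in auto)
  obtain u3 where u3: "x2 < u3" "u3 < x3" "g1 u3 = 0"
    by (rule rolle_zero[of x2 x3 g g1]) (use ord z2 z3 d in auto)
  obtain v1 where v1: "u1 < v1" "v1 < u2" "g2 v1 = 0"
    by (rule rolle_zero[of u1 u2 g1 g2]) (use ord u1 u2 u3 d1 in auto)
  obtain v2 where v2: "u2 < v2" "v2 < u3" "g2 v2 = 0"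
    by (rule rolle_zero[of u2 u3 g1 g2]) (use ord u1 u2 u3 d1 in auto)
  obtain z where z: "v1 < z" "z < v2" "g3 z = 0"
    by (rule rolle_zero[of v1 v2 g2 g3]) (use ord u1 u2 u3 v1 v2 d2 in auto)
  show thesis
  proof (rule that[of z])
    show "divided_diff [x0, x1, x2, x3] h = h3 z / 6"
      using z(3) unfolding g3_def c_def by linarith
  qed (use u1 u3 v1 v2 z in auto)
qed

lemma log_concave_order2_on_Gamma: "log_concave_order2_on {0<..} (Gamma :: real \<Rightarrow> real)"
  unfolding log_concave_order2_on_def
proof (intro conjI ballI impI)
  fix x0 x1 x2 x3 :: real
  assume "x0 \<in> {0<..}" and ord: "x0 < x1 \<and> x1 < x2 \<and> x2 < x3"
  hence pos: "x0 > 0" by simp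
  have nonpos: "x \<notin> \<int>\<^sub>\<le>\<^sub>0" if "x0 \<le> x" for x
    using pos that by (auto elim!: nonpos_Ints_cases)
  have ln_Gamma: "((\<lambda>x. ln (Gamma x)) has_real_derivative Polygamma 0 x) (at x)"
    if "x0 \<le> x" for x
  \<comment> \<open>The derivative of \<open>ln_Gamma\<close> carries over because both functions
    agree on the open set of positive reals.\<close>
  proof (rule has_field_derivative_transform_within_open)
    show "(ln_Gamma has_real_derivative Polygamma 0 x) (at x)"
      using pos that by (auto intro!: derivative_eq_intros)
    show "ln_Gamma y = ln (Gamma y)" if "y \<in> {0<..}" for y :: real
      using that by (simp add: ln_Gamma_real_pos)
  qed (use pos that in auto)
  obtain z where "x0 < z" "divided_diff [x0, x1, x2, x3] (\<lambda>x. ln (Gamma x)) = Polygamma 2 z / 6"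
    by (rule divided_diff_3_mean_value[of x0 x1 x2 x3 "\<lambda>x. ln (Gamma x)"
          "Polygamma 0" "Polygamma 1" "Polygamma 2"])
      (use ord nonpos ln_Gamma in \<open>auto intro!: derivative_eq_intros simp: numeral_2_eq_2\<close>)
  moreover have "Polygamma 2 z < 0" using pos \<open>x0 < z\<close> by (intro Polygamma_real_even_neg) auto
  ultimately show "divided_diff [x0, x1, x2, x3] (\<lambda>x. ln (Gamma x)) \<le> 0" by linarith
qed simp

text \<open>Newton's forward form of the quadratic through the points of \<open>h\<close> at
  \<open>m\<close>, \<open>m + 1\<close>, \<open>m + 2\<close>, evaluated at
  \<open>m + s\<close>.\<close>

definition interpolant :: "(real \<Rightarrow> real) \<Rightarrow> real \<Rightarrow> real \<Rightarrow> real" where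
  "interpolant h m s = h m + (h (m + 1) - h m) * s +
     (h (m + 2) - 2 * h (m + 1) + h m) / 2 * (s * (s - 1))"

text \<open>The interpolation error at a point is the divided difference with that point added,
  times the node polynomial. Here the latter is \<open>t * (t - 1) * (t - 2)\<close>, which is
  positive.\<close>

lemma interpolant_upper:
  assumes "0 < t" "t < 1" "divided_diff [m, m + t, m + 1, m + 2] h \<le> 0"
  shows "h (m + t) \<le> interpolant h m t"
proof -
  have "divided_diff [m, m + t, m + 1, m + 2] h * (t * (1 - t) * (2 - t)) =
      h (m + t) - interpolant h m t"
    using assms(1,2) unfolding divided_diff_3 interpolant_def
    by (simp add: divide_simps) algebra
  moreover have "t * (1 - t) * (2 - t) > 0" using assms by simp
  ultimately show ?thesis using assms(3)
    by (metis diff_le_0_iff_le mult_le_0_iff less_imp_le)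
qed

text \<open>The same error formula, now between the last two nodes, where the node polynomial
  \<open>(1 + t) * t * (t - 1)\<close> is negative.\<close>

lemma interpolant_lower:
  assumes "0 < t" "t < 1" "divided_diff [m, m + 1, m + 1 + t, m + 2] h \<le> 0"
  shows "interpolant h m (1 + t) \<le> h (m + 1 + t)"
proof -
  have "divided_diff [m, m + 1, m + 1 + t, m + 2] h * (t * (1 - t) * (1 + t)) =
      interpolant h m (1 + t) - h (m + 1 + t)"
    using assms(1,2) unfolding divided_diff_3 interpolant_def
    by (simp add: divide_simps) algebra
  moreover have "t * (1 - t) * (1 + t) > 0" using assms by simp
  ultimately show ?thesis using assms(3)
    by (metis diff_le_0_iff_le mult_le_0_iff less_imp_le)
qed

text \<open>Both quadratics agree at \<open>m + 1\<close> and \<open>m + 2\<close>, so their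
  difference is a multiple of \<open>t * (t - 1)\<close>; the factor is half the third forward
  difference.\<close>

lemma interpolant_diff:
  "interpolant h (m + 1) t - interpolant h m (1 + t) =
     (h (m + 3) - 3 * h (m + 2) + 3 * h (m + 1) - h m) / 2 * (t * (t - 1))"
  unfolding interpolant_def by (simp add: field_simps)

lemma interpolant_cong:
  assumes "h m = k m" "h (m + 1) = k (m + 1)" "h (m + 2) = k (m + 2)"
  shows "interpolant h m s = interpolant k m s"
  using assms by (simp add: interpolant_def)

text \<open>The common values at \<open>m, ..., m + 3\<close> give both logarithms the same two
  interpolants, so both values lie in one interval, whose length is the bound.\<close>

lemma log_concave_order2_gap:
  fixes f g :: "real \<Rightarrow> real"
  assumes f: "log_concave_order2_on {0<..} f" and g: "log_concave_order2_on {0<..} g"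
    and m: "m > 0" and t: "0 < t" "t < 1"
    and eq: "f m = g m" "f (m + 1) = g (m + 1)" "f (m + 2) = g (m + 2)" "f (m + 3) = g (m + 3)"
  shows "\<bar>ln (f (m + 1 + t)) - ln (g (m + 1 + t))\<bar> \<le>
    (ln (g (m + 3)) - 3 * ln (g (m + 2)) + 3 * ln (g (m + 1)) - ln (g m)) / 2 * (t * (t - 1))"
proof -
  let ?g = "\<lambda>x. ln (g x)"
  have bounds: "ln (p (m + 1 + t)) \<in> {interpolant ?g m (1 + t) .. interpolant ?g (m + 1) t}"
    if "log_concave_order2_on {0<..} p" "p m = g m" "p (m + 1) = g (m + 1)"
       "p (m + 2) = g (m + 2)" "p (m + 3) = g (m + 3)" for p
  proof -
    let ?p = "\<lambda>x. ln (p x)"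
    have "interpolant ?p m (1 + t) \<le> ?p (m + 1 + t)"
      using m t by (intro interpolant_lower log_concave_order2_onD[OF that(1)]) auto
    moreover have "?p (m + 1 + t) \<le> interpolant ?p (m + 1) t"
      using m t by (intro interpolant_upper log_concave_order2_onD[OF that(1)]) auto
    moreover have "interpolant ?p m (1 + t) = interpolant ?g m (1 + t)"
      "interpolant ?p (m + 1) t = interpolant ?g (m + 1) t"
      using that by (auto intro!: interpolant_cong simp: add.assoc)
    ultimately show ?thesis by simp
  qed
  show ?thesis
    using bounds[OF f eq] bounds[OF g refl refl refl refl]
    unfolding interpolant_diff[of ?g m t, symmetric] by auto
qed

text \<open>Shifting by \<open>n\<close> multiplies both functions by the same positive factor
  \<open>pochhammer x n\<close>, which cancels.\<close>

lemma recurrence_eq_shift: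
  fixes f g :: "real \<Rightarrow> real"
  assumes "\<And>x. x > 0 \<Longrightarrow> f (x + 1) = x * f x" "\<And>x. x > 0 \<Longrightarrow> g (x + 1) = x * g x" "x > 0"
  shows "f (x + real n) = g (x + real n) \<longleftrightarrow> f x = g x"
    and "f (x + real n) / g (x + real n) = f x / g x"
proof -
  have "p (x + real n) = pochhammer x n * p x"
    if "\<And>y. y > 0 \<Longrightarrow> p (y + 1) = y * p y" for p :: "real \<Rightarrow> real"
  proof (induction n)
    case (Suc n)
    have "p (x + real (Suc n)) = p ((x + real n) + 1)" by (simp add: add_ac)
    also have "\<dots> = (x + real n) * p (x + real n)" using assms(3) by (intro that) simp
    finally show ?case using Suc by (simp add: pochhammer_Suc)
  qed simp
  hence "f (x + real n) = pochhammer x n * f x" "g (x + real n) = pochhammer x n * g x"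
    using assms(1,2) by blast+
  moreover have "pochhammer x n > 0" using assms(3) by (rule pochhammer_pos)
  ultimately show "f (x + real n) = g (x + real n) \<longleftrightarrow> f x = g x"
    "f (x + real n) / g (x + real n) = f x / g x" by simp_all
qed

lemma Gamma_real_plus1: "x > 0 \<Longrightarrow> Gamma (x + 1) = x * Gamma (x :: real)"
  by (intro Gamma_plus1) (auto elim!: nonpos_Ints_cases)

theorem corollary3p3:
  fixes f :: "real \<Rightarrow> real"
  shows "(f \<in> {0<..} \<rightarrow> {0<..} \<and>
          (\<forall>x>0. f (x + 1) = x * f x) \<and>
          f 1 = 1 \<and>
          log_concave_order2_on {0<..} f)
         \<longleftrightarrow> (\<forall>x>0. f x = Gamma x)"
proof
  assume *: "\<forall>x>0. f x = Gamma x"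
  have "log_concave_order2_on {0<..} f"
    using log_concave_order2_on_Gamma * unfolding log_concave_order2_on_def by auto
  thus "f \<in> {0<..} \<rightarrow> {0<..} \<and> (\<forall>x>0. f (x + 1) = x * f x) \<and> f 1 = 1 \<and>
      log_concave_order2_on {0<..} f"
    using * by (auto simp: Gamma_real_plus1)
next
  assume "f \<in> {0<..} \<rightarrow> {0<..} \<and> (\<forall>x>0. f (x + 1) = x * f x) \<and> f 1 = 1 \<and>
      log_concave_order2_on {0<..} f"
  hence pos: "\<And>x. x > 0 \<Longrightarrow> f x > 0" and rec: "\<And>x. x > 0 \<Longrightarrow> f (x + 1) = x * f x"
    and one: "f 1 = 1" and lc: "log_concave_order2_on {0<..} f" by auto
  note shift = recurrence_eq_shift[of f Gamma, OF rec Gamma_real_plus1]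
  have nat: "f (1 + real n) = Gamma (1 + real n)" for n
    using shift(1)[of 1 n] one by simp
  have unit: "f t = Gamma t" if t: "0 < t" "t < 1" for t
  proof -
    let ?d = "ln (f t / Gamma t)"
    \<comment> \<open>By the functional equation, the third difference of \<open>ln Gamma\<close> at
      \<open>n + 1\<close> is the second difference of \<open>ln\<close> there, which tends to
      0.\<close>
    let ?b = "\<lambda>n. (ln (real n + 3) - 2 * ln (real n + 2) + ln (real n + 1)) / 2 * (t * (t - 1))"
    have bound: "\<bar>?d\<bar> \<le> ?b n" for n
    proof -
      define m where "m = 1 + real n"
      have m: "m > 0" by (simp add: m_def)
      have eq: "f m = Gamma m" "f (m + 1) = Gamma (m + 1)" "f (m + 2) = Gamma (m + 2)"
        "f (m + 3) = Gamma (m + 3)"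
        using nat[of n] nat[of "n + 1"] nat[of "n + 2"] nat[of "n + 3"]
        by (simp_all add: m_def add_ac)
      have step: "ln (Gamma (x + 1)) = ln x + ln (Gamma x)" if "x > 0" for x :: real
        using that Gamma_real_plus1[OF that] by (simp add: ln_mult_pos)
      have "ln (Gamma (m + 3)) - 3 * ln (Gamma (m + 2)) + 3 * ln (Gamma (m + 1)) - ln (Gamma m) =
          ln (m + 2) - 2 * ln (m + 1) + ln m"
        using step[of m] step[of "m + 1"] step[of "m + 2"] m by (simp add: add.assoc)
      moreover have "?d = ln (f (m + 1 + t)) - ln (Gamma (m + 1 + t))"
      proof -
        have "t + real (n + 2) = m + 1 + t" by (simp add: m_def)
        hence "f (m + 1 + t) / Gamma (m + 1 + t) = f t / Gamma t"
          using shift(2)[of t "n + 2"] t(1) by metis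
        thus ?thesis using t m pos by (metis Gamma_real_pos add_pos_pos ln_divide_pos zero_less_one)
      qed
      ultimately show ?thesis
        using log_concave_order2_gap[OF lc log_concave_order2_on_Gamma m t eq]
        by (simp add: m_def add_ac)
    qed
    have "?b \<longlonglongrightarrow> 0" by real_asymp
    hence "\<bar>?d\<bar> \<le> 0" by (rule LIMSEQ_le_const) (use bound in blast)
    moreover have "f t > 0" "Gamma t > 0" using t pos by auto
    ultimately show ?thesis by simp
  qed
  show "\<forall>x>0. f x = Gamma x"
  proof (intro allI impI)
    fix x :: real assume x: "x > 0"
    \<comment> \<open>The ceiling minus one, rather than the floor, puts \<open>t\<close> in
      \<open>(0, 1]\<close>: integers are sent to 1, where \<open>f 1 = 1\<close> applies, and not
      to 0, outside the domain.\<close>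
    define n where "n = nat (\<lceil>x\<rceil> - 1)"
    define t where "t = x - real n"
    have "real n = of_int \<lceil>x\<rceil> - 1" using x by (simp add: n_def)
    hence t: "0 < t" "t \<le> 1" using ceiling_correct[of x] by (auto simp: t_def)
    have "f t = Gamma t" using unit[of t] one t by (cases "t = 1") auto
    thus "f x = Gamma x" using shift(1)[of t n] t by (simp add: t_def)
  qed
qed

end
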